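(* Let $n\ge 1$, and consider the multi-device system consisting of $n$ devices with $2\times 2$ admittance transfer matrices $Y_1(s),\dots,Y_n(s)$, ${\bf Y}(s)=\mathrm{diag}(Y_1(s),\dots,Y_n(s))$, interconnected through a power network with admittance matrix $Q_{\rm red}\otimes F(s)$, i.e. the feedback system with open-loop transfer function matrix $${\bf L}(s) = -\left[Q_{\rm red}\otimes F(s)\right]^{-1}{\bf Y}(s).$$ Let $\lambda_1>0$ be the smallest eigenvalue of the symmetric matrix $Q_{\rm red}$. If $$\max_{i\in\{1,\dots,n\}} \left\|F^{-1}(s)Y_i(s)\right\|_\infty < \lambda_1,$$ where $\|\cdot\|_\infty$ denotes the $\mathcal H_\infty$ norm, then the multi-device system is stable.
   Context: Setting. There are $n$ devices (e.g. power converters) interconnected by a (Kron-reduced) power network. Signals are two-dimensional vectors in a global $dq$ frame rotating at constant nominal angular frequency $\omega_0>0$. Device $i$ has terminal voltage $U_i$ and current $I_i$ related by $I_i=Y_i(s)U_i$, where $Y_i(s)$ is a $2\times2$ real-rational transfer function matrix (linearized admittance). Stacking, ${\bf U}=[U_1^\top\,\dots\,U_n^\top]^\top$, ${\bf I}=[I_1^\top\,\dots\,I_n^\top]^\top$, and ${\bf I}={\bf Y}(s){\bf U}$ with ${\bf Y}(s)=\mathrm{diag}(Y_1(s),\dots,Y_n(s))$ block diagonal. Network. All lines have the same resistance/inductance ratio $\tau\ge 0$. The line between nodes $i\neq j$ obeys $I_{ij}=B_{ij}F(s)(U_i-U_j)$, where $B_{ij}=B_{ji}\ge 0$ is its susceptance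 and $$F(s)=\frac{1}{(s+\tau)^2/\omega_0+\omega_0}\begin{bmatrix}s+\tau&\omega_0\\-\omega_0&s+\tau\end{bmatrix}.$$ $Q_{\rm red}\in\mathbb R^{n\times n}$ is the symmetric grounded Laplacian of the network: $(Q_{\rm red})_{ij}=-B_{ij}$ for $i\neq j$ and $(Q_{\rm red})_{ii}=\sum_{j=1}^n B_{ij}$, where $B_{ii}\ge 0$ is the susceptance between node $i$ and the grounded node (the infinite bus). The network satisfies ${\bf I}=[Q_{\rm red}\otimes F(s)]{\bf U}$, equivalently ${\bf U}=[Q_{\rm red}\otimes F(s)]^{-1}{\bf I}$, where $\otimes$ is the Kronecker product. Conventions. For a transfer function matrix $M(s)$, $\|M\|_\infty=\max_{\omega}\bar\sigma(M(j\omega))$ ($\bar\sigma$ = largest singular value, maximum/supremum over real $\omega$); writing that this $\mathcal H_\infty$ norm is finite (in particular, bounded by a finite number) includes that $M$ is real-rational, proper and has all its poles in the open left half-plane. The closed loop is formed by ${\bf I}={\bf Y}(s){\bf U}$ together with ${\bf U}=[Q_{\rm red}\otimes F(s)]^{-1}{\bf I}$, so its return difference is $\mathcal I_{2n}+{\bf L}(s)$, where $\mathcal I_{2n}$ is the $2n\times 2n$ identity matrix. The multi-device system is called stable if $\mathcal I_{2n}+{\bf L}(s)$ is invertible as a rational matrix and its inverse $(\mathcal I_{2n}+{\bf L}(s))^{-1}$ is proper with all its poles in the open left half-plane. *)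

theory Defs
  imports
    "HOL-Analysis.Analysis"
    "HOL-Computational_Algebra.Polynomial_Factorial"
    "HOL-Computational_Algebra.Field_as_Ring"
begin

section \<open>Real-rational transfer functions\<close>

type_synonym ratfun = "real poly fract"

definition rconst :: "real \<Rightarrow> ratfun"
  where "rconst c = to_fract [:c:]"

definition rvar :: ratfun
  where "rvar = to_fract [:0, 1:]"

text \<open>Poles, values and properness are read off the coprime representation with monic denominator
  that \<^const>\<open>quot_of_fract\<close> provides, so removable singularities do not count as poles.\<close>

definition rnum :: "ratfun \<Rightarrow> real poly"
  where "rnum r = fst (quot_of_fract r)"

definition rden :: "ratfun \<Rightarrow> real poly"
  where "rden r = snd (quot_of_fract r)"

text \<open>At a pole the value is the dummy value 0 of division by zero; below, \<open>reval\<close> is used only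
  where there are no poles.\<close>

definition reval :: "ratfun \<Rightarrow> complex \<Rightarrow> complex"
  where "reval r z = poly (map_poly of_real (rnum r)) z / poly (map_poly of_real (rden r)) z"

definition rpoles :: "ratfun \<Rightarrow> complex set"
  where "rpoles r = {z. poly (map_poly of_real (rden r)) z = 0}"

definition rproper :: "ratfun \<Rightarrow> bool"
  where "rproper r \<longleftrightarrow> degree (rnum r) \<le> degree (rden r)"

text \<open>A pole of a transfer matrix is a pole of one of its entries.\<close>

definition proper_stable :: "ratfun^'n^'m \<Rightarrow> bool"
  where "proper_stable M \<longleftrightarrow>
    (\<forall>i j. rproper (M $ i $ j) \<and> (\<forall>z\<in>rpoles (M $ i $ j). Re z < 0))"

definition meval :: "ratfun^'n^'m \<Rightarrow> complex \<Rightarrow> complex^'n^'m"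
  where "meval M z = map_matrix (\<lambda>r. reval r z) M"


section \<open>Eigenvalues, singular values and the H-infinity norm\<close>

definition mat_eigenvalue :: "'a::field^'n^'n \<Rightarrow> 'a \<Rightarrow> bool"
  where "mat_eigenvalue A k \<longleftrightarrow> (\<exists>v. v \<noteq> 0 \<and> A *v v = k *s v)"

definition mat_adjoint :: "complex^'n^'m \<Rightarrow> complex^'m^'n"
  where "mat_adjoint A = map_matrix cnj (transpose A)"

definition singular_value :: "complex^'n^'m \<Rightarrow> real \<Rightarrow> bool"
  where "singular_value A s \<longleftrightarrow>
    0 \<le> s \<and> mat_eigenvalue (mat_adjoint A ** A) (complex_of_real (s\<^sup>2))"

definition max_singular_value :: "complex^'n^'m \<Rightarrow> real"
  where "max_singular_value A = Max {s. singular_value A s}"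

text \<open>The norm is \<open>\<infinity>\<close> unless the matrix is proper with all poles in the open left half-plane, so a
  finite bound on it includes these properties.\<close>

definition hinf_norm :: "ratfun^'n^'m \<Rightarrow> ereal"
  where "hinf_norm M =
    (if proper_stable M
     then (SUP w::real. ereal (max_singular_value (meval M (\<i> * complex_of_real w))))
     else \<infinity>)"


section \<open>The power network and the closed loop\<close>

text \<open>Block matrices of size \<open>2n\<close> are indexed by pairs (device, dq-component).\<close>

definition kronecker :: "'a::times^'n^'m \<Rightarrow> 'a^'q^'p \<Rightarrow> 'a^('n \<times> 'q)^('m \<times> 'p)"  (infixl "\<otimes>\<^sub>K" 70)
  where "A \<otimes>\<^sub>K B = (\<chi> r c. A $ fst r $ fst c * B $ snd r $ snd c)"

definition block_diag :: "('n::finite \<Rightarrow> 'a::zero^'q^'p) \<Rightarrow> 'a^('n \<times> 'q)^('n \<times> 'p)"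
  where "block_diag Y = (\<chi> r c. if fst r = fst c then Y (fst r) $ snd r $ snd c else 0)"

definition line_dynamics :: "real \<Rightarrow> real \<Rightarrow> ratfun^2^2"
  where "line_dynamics \<omega>0 \<tau> =
    map_matrix (\<lambda>x. 1 / ((rvar + rconst \<tau>)\<^sup>2 / rconst \<omega>0 + rconst \<omega>0) * x)
      (vector [vector [rvar + rconst \<tau>, rconst \<omega>0],
               vector [- rconst \<omega>0, rvar + rconst \<tau>]])"

text \<open>\<open>B i i\<close> is the susceptance between node \<open>i\<close> and the grounded node; it contributes to the
  diagonal sum.\<close>

definition grounded_laplacian :: "('n::finite \<Rightarrow> 'n \<Rightarrow> real) \<Rightarrow> real^'n^'n"
  where "grounded_laplacian B = (\<chi> i j. if i = j then (\<Sum>k\<in>UNIV. B i k) else - B i j)"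

definition network_admittance :: "real^'n^'n \<Rightarrow> ratfun^2^2 \<Rightarrow> ratfun^('n \<times> 2)^('n \<times> 2)"
  where "network_admittance Q F = map_matrix rconst Q \<otimes>\<^sub>K F"

definition open_loop ::
    "real^'n^'n \<Rightarrow> ratfun^2^2 \<Rightarrow> ('n \<Rightarrow> ratfun^2^2) \<Rightarrow> ratfun^('n \<times> 2)^('n \<times> 2)"
  where "open_loop Q F Y = - (matrix_inv (network_admittance Q F) ** block_diag Y)"

definition closed_loop_stable :: "ratfun^'k^'k \<Rightarrow> bool"
  where "closed_loop_stable L \<longleftrightarrow>
    invertible (mat 1 + L) \<and> proper_stable (matrix_inv (mat 1 + L))"

end

theory Submission
  imports Defs "HOL-Complex_Analysis.Conformal_Mappings"
begin

text \<open>Put \<open>G\<^sub>i = F\<^sup>-\<^sup>1 Y\<^sub>i\<close>, \<open>D = diag(G\<^sub>1, \<dots>, G\<^sub>n)\<close> and \<open>P = Q \<otimes> I\<close>. The line dynamics cancel and the return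
  difference satisfies \<open>P (I + L) = P - D\<close>. The norm bound on the imaginary axis extends to the
  right half-plane by the maximum principle, so \<open>\<parallel>D(z) x\<parallel> \<le> c \<parallel>x\<parallel>\<close> there with \<open>c < \<lambda>\<^sub>1\<close>, while
  \<open>\<parallel>P x\<parallel> \<ge> \<lambda>\<^sub>1 \<parallel>x\<parallel>\<close>. Hence \<open>\<parallel>(P - D(z)) x\<parallel> \<ge> (\<lambda>\<^sub>1 - c) \<parallel>x\<parallel>\<close>, which makes \<open>P - D\<close> invertible and
  \<open>(I + L)\<^sup>-\<^sup>1 = (P - D)\<^sup>-\<^sup>1 P\<close> bounded on the right half-plane outside finitely many points. A rational
  function with this property is proper and has no pole in the closed right half-plane.\<close>


section \<open>Evaluation of rational functions\<close>

abbreviation cval :: "real poly \<Rightarrow> complex \<Rightarrow> complex"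
  where "cval p z \<equiv> poly (map_poly of_real p) z"

lemma cval_add: "cval (p + q) z = cval p z + cval q z"
proof -
  have "map_poly of_real (p + q) = map_poly complex_of_real p + map_poly of_real q"
    by (intro poly_eqI) (simp add: coeff_map_poly)
  then show ?thesis by simp
qed

lemma cval_mult: "cval (p * q) z = cval p z * cval q z"
  by (induction p)
     (simp_all add: cval_add map_poly_pCons map_poly_smult algebra_simps)

lemma map_poly_of_real_eq_0_iff: "map_poly complex_of_real p = 0 \<longleftrightarrow> p = 0"
  by (intro map_poly_eq_0_iff) auto

lemma finite_cval_roots: "p \<noteq> 0 \<Longrightarrow> finite {z. cval p z = 0}"
  by (intro poly_roots_finite) (simp add: map_poly_of_real_eq_0_iff)

lemma rden_nonzero: "rden r \<noteq> 0"
  by (simp add: rden_def)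

lemma Fract_rnum_rden: "Fract (rnum r) (rden r) = r"
  by (simp add: rnum_def rden_def)

lemma finite_rpoles: "finite (rpoles r)"
  unfolding rpoles_def by (rule finite_cval_roots[OF rden_nonzero])

text \<open>By coprimality the reduced denominator divides \<open>q\<close>, so it cannot vanish
  where \<open>q\<close> does not. Hence sums and products can be evaluated from any representation
  whose denominator is nonzero at the point, without reducing it to lowest terms.\<close>

lemma reval_Fract:
  assumes "cval q z \<noteq> 0"
  shows "z \<notin> rpoles (Fract p q)" and "reval (Fract p q) z = cval p z / cval q z"
proof -
  define r where "r = Fract p q"
  have q: "q \<noteq> 0" using assms by auto
  have cross: "rnum r * q = p * rden r"
    using Fract_rnum_rden[of r] q by (simp add: r_def eq_fract rden_nonzero)
  have "coprime (rden r) (rnum r)"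
    unfolding rnum_def rden_def using coprime_quot_of_fract by (metis coprime_commute)
  moreover have "rden r dvd rnum r * q" by (simp add: cross)
  ultimately have "rden r dvd q" by (simp add: coprime_dvd_mult_right_iff)
  then obtain k where "q = rden r * k" by (elim dvdE)
  then have nz: "cval (rden r) z \<noteq> 0" using assms by (auto simp: cval_mult)
  then show "z \<notin> rpoles (Fract p q)" by (simp add: rpoles_def r_def)
  have "cval (rnum r) z * cval q z = cval p z * cval (rden r) z"
    unfolding cval_mult[symmetric] cross ..
  then show "reval (Fract p q) z = cval p z / cval q z"
    using nz assms by (simp add: reval_def r_def field_simps)
qed

lemma reval_add:
  assumes "z \<notin> rpoles a" "z \<notin> rpoles b"
  shows "z \<notin> rpoles (a + b)" and "reval (a + b) z = reval a z + reval b z"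
proof -
  have nz: "cval (rden a) z \<noteq> 0" "cval (rden b) z \<noteq> 0"
    using assms by (simp_all add: rpoles_def)
  have eq: "a + b = Fract (rnum a * rden b + rnum b * rden a) (rden a * rden b)"
    using add_fract[OF rden_nonzero rden_nonzero, of "rnum a" a "rnum b" b]
    by (simp add: Fract_rnum_rden)
  have nz': "cval (rden a * rden b) z \<noteq> 0" using nz by (simp add: cval_mult)
  show "z \<notin> rpoles (a + b)" unfolding eq by (rule reval_Fract[OF nz'])
  show "reval (a + b) z = reval a z + reval b z"
    unfolding eq reval_Fract(2)[OF nz'] using nz
    by (simp add: reval_def cval_mult cval_add add_frac_eq)
qed

lemma reval_mult:
  assumes "z \<notin> rpoles a" "z \<notin> rpoles b"
  shows "z \<notin> rpoles (a * b)" and "reval (a * b) z = reval a z * reval b z"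
proof -
  have nz: "cval (rden a) z \<noteq> 0" "cval (rden b) z \<noteq> 0"
    using assms by (simp_all add: rpoles_def)
  have eq: "a * b = Fract (rnum a * rnum b) (rden a * rden b)"
    using mult_fract[of "rnum a" "rden a" "rnum b" "rden b"]
    by (simp add: Fract_rnum_rden)
  have nz': "cval (rden a * rden b) z \<noteq> 0" using nz by (simp add: cval_mult)
  show "z \<notin> rpoles (a * b)" unfolding eq by (rule reval_Fract[OF nz'])
  show "reval (a * b) z = reval a z * reval b z"
    unfolding eq reval_Fract(2)[OF nz'] using nz
    by (simp add: reval_def cval_mult)
qed

lemma reval_rconst: "z \<notin> rpoles (rconst c)" "reval (rconst c) z = of_real c"
proof -
  have eq: "rconst c = Fract [:c:] 1"
    by (simp add: rconst_def to_fract_def)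
  have nz: "cval 1 z \<noteq> 0" by simp
  show "z \<notin> rpoles (rconst c)" "reval (rconst c) z = of_real c"
    using reval_Fract[OF nz, of "[:c:]"] by (simp_all add: eq map_poly_pCons)
qed

lemma rconst_hom [simp]:
  "rconst 0 = 0" "rconst 1 = 1" "rconst (- a) = - rconst a"
  "rconst (a + b) = rconst a + rconst b" "rconst (a * b) = rconst a * rconst b"
  by (simp_all add: rconst_def to_fract_def Zero_fract_def One_fract_def one_pCons mult.commute)

lemma reval_0: "z \<notin> rpoles 0" "reval 0 z = 0"
  using reval_rconst[where z = z and c = 0] by simp_all

lemma reval_uminus:
  assumes "z \<notin> rpoles a"
  shows "z \<notin> rpoles (- a)" and "reval (- a) z = - reval a z"
  using reval_mult[OF reval_rconst(1)[where c = "-1"] assms] reval_rconst(2)[of "-1" z]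
  by simp_all

lemma reval_sum:
  assumes "finite I" and "\<And>i. i \<in> I \<Longrightarrow> z \<notin> rpoles (f i)"
  shows "z \<notin> rpoles (sum f I)" and "reval (sum f I) z = (\<Sum>i\<in>I. reval (f i) z)"
  using assms by (induction I rule: finite_induct) (simp_all add: reval_0 reval_add)

text \<open>Besides the roots of the numerator, the set contains the poles, where
  \<open>reval\<close> takes the dummy value 0; both sets are finite.\<close>

lemma finite_reval_zeros:
  assumes "r \<noteq> 0"
  shows "finite {z. reval r z = 0}"
proof -
  have "rnum r \<noteq> 0" using assms by (simp add: rnum_def)
  then have "finite ({z. cval (rnum r) z = 0} \<union> rpoles r)"
    by (simp add: finite_cval_roots finite_rpoles)
  then show ?thesis
    by (rule finite_subset[rotated]) (auto simp: reval_def rpoles_def)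
qed


section \<open>Proper stable rational functions\<close>

text \<open>The quotient is a polynomial in \<open>1/z\<close> with constant term
  \<open>coeff p n\<close>. Taking \<open>n\<close> above the degree is allowed and gives the limit
  0.\<close>

lemma poly_div_power_tendsto:
  fixes p :: "complex poly"
  assumes "degree p \<le> n"
  shows "((\<lambda>z. poly p z / z ^ n) \<longlongrightarrow> coeff p n) at_infinity"
proof -
  have "((\<lambda>z. \<Sum>i\<le>n. coeff p i * inverse z ^ (n - i)) \<longlongrightarrow>
      (\<Sum>i\<le>n. coeff p i * 0 ^ (n - i))) at_infinity"
    by (intro tendsto_intros tendsto_inverse_0)
  moreover have "(\<Sum>i\<le>n. coeff p i * 0 ^ (n - i)) = (\<Sum>i\<le>n. if i = n then coeff p i else 0)"
    by (intro sum.cong) auto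
  moreover have "\<forall>\<^sub>F z in at_infinity.
      (\<Sum>i\<le>n. coeff p i * inverse z ^ (n - i)) = poly p z / z ^ n"
    using eventually_not_equal_at_infinity[of 0]
  proof eventually_elim
    case (elim z)
    have "poly p z = (\<Sum>i\<le>n. coeff p i * z ^ i)"
      unfolding poly_altdef
      by (intro sum.mono_neutral_left) (use assms in \<open>auto simp: coeff_eq_0\<close>)
    moreover have "inverse z ^ (n - i) = z ^ i / z ^ n" if "i \<le> n" for i
      using that elim by (simp add: power_diff field_simps)
    ultimately show ?case by (simp add: sum_divide_distrib)
  qed
  ultimately show ?thesis
    by (simp add: filterlim_cong)
qed

text \<open>After division by the power \<open>z ^ m\<close>, with \<open>m\<close> the degree of
  the denominator, numerator and denominator have finite limits at infinity, the second one nonzero;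
  this bounds \<open>r\<close> outside a large disc. On the remaining closed half-disc
  \<open>r\<close> is continuous and compactness applies.\<close>

lemma proper_stable_bounded:
  assumes "rproper r" and "\<forall>z\<in>rpoles r. Re z < 0"
  shows "\<exists>C. \<forall>z. 0 \<le> Re z \<longrightarrow> norm (reval r z) \<le> C"
proof -
  define m where "m = degree (rden r)"
  let ?p = "map_poly complex_of_real (rnum r)" and ?q = "map_poly complex_of_real (rden r)"
  have dq: "degree ?q = m" by (simp add: m_def degree_map_poly)
  have dp: "degree ?p \<le> m" using assms(1) by (simp add: m_def degree_map_poly rproper_def)
  have lq: "coeff ?q m \<noteq> 0"
    using rden_nonzero[of r] dq map_poly_of_real_eq_0_iff[of "rden r"]
    by (metis leading_coeff_0_iff)
  have "((\<lambda>z. (poly ?p z / z ^ m) / (poly ?q z / z ^ m)) \<longlongrightarrow> coeff ?p m / coeff ?q m) at_infinity"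
    using lq dq by (intro tendsto_divide poly_div_power_tendsto dp) auto
  then have "\<forall>\<^sub>F z in at_infinity. dist ((poly ?p z / z ^ m) / (poly ?q z / z ^ m)) (coeff ?p m / coeff ?q m) < 1"
    by (rule tendstoD) simp
  then have "\<forall>\<^sub>F z in at_infinity. norm (reval r z) \<le> 1 + norm (coeff ?p m / coeff ?q m)"
    using eventually_not_equal_at_infinity[of 0]
  proof eventually_elim
    case (elim z)
    then have "dist (reval r z) (coeff ?p m / coeff ?q m) < 1" by (simp add: reval_def)
    then show ?case using norm_triangle_sub[of "reval r z" "coeff ?p m / coeff ?q m"]
      by (simp add: dist_norm)
  qed
  then obtain R where R: "\<And>z. R \<le> norm z \<Longrightarrow> norm (reval r z) \<le> 1 + norm (coeff ?p m / coeff ?q m)"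
    by (auto simp: eventually_at_infinity)
  let ?K = "cball 0 R \<inter> {z. 0 \<le> Re z}"
  have "compact ?K"
    by (intro compact_Int_closed compact_cball closed_halfspace_Re_ge)
  moreover have "continuous_on ?K (reval r)"
    unfolding reval_def
    by (intro continuous_intros) (use assms(2) in \<open>force simp: rpoles_def\<close>)
  ultimately have "bounded (reval r ` ?K)"
    using compact_continuous_image compact_imp_bounded by blast
  then obtain C where C: "\<And>z. z \<in> ?K \<Longrightarrow> norm (reval r z) \<le> C"
    unfolding bounded_iff by (metis image_eqI)
  have "norm (reval r z) \<le> max C (1 + norm (coeff ?p m / coeff ?q m))" if "0 \<le> Re z" for z
    using R[of z] C[of z] that by (cases "R \<le> norm z") (auto simp: max_def)
  then show ?thesis by blast
qed

text \<open>A pole in the closed half-plane, or at infinity, is a limit of points of the open half-plane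
  outside the finite exceptional set.\<close>

lemma bounded_imp_proper_stable:
  assumes X: "finite X" and bd: "\<And>z. 0 < Re z \<Longrightarrow> z \<notin> X \<Longrightarrow> norm (reval r z) \<le> C"
  shows "rproper r" and "\<forall>z\<in>rpoles r. Re z < 0"
proof -
  let ?p = "map_poly complex_of_real (rnum r)" and ?q = "map_poly complex_of_real (rden r)"
  have fin: "finite (X \<union> rpoles r)" using X finite_rpoles by simp
  \<comment> \<open>Clearing the denominator leaves an inequality between continuous functions,
    which survives passage to a limit at a pole.\<close>
  have bd': "norm (poly ?p z) \<le> C * norm (poly ?q z)"
    if "0 < Re z" "z \<notin> X \<union> rpoles r" for z
    using bd[of z] that
    by (auto simp: reval_def rpoles_def norm_divide divide_le_eq split: if_splits)
  show "rproper r"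
  proof (rule ccontr)
    assume "\<not> rproper r"
    then have less: "degree (rden r) < degree (rnum r)" by (simp add: rproper_def)
    define n where "n = degree ?p"
    have n: "n = degree (rnum r)" by (simp add: n_def degree_map_poly)
    have q: "degree ?q < n" using less by (simp add: n degree_map_poly)
    have inf: "filterlim (\<lambda>x. complex_of_real x) at_infinity at_top"
      by (rule filterlim_of_real_at_infinity)
    \<comment> \<open>Both sides are scaled by the degree of the numerator along the positive real
      axis. In the limit the leading coefficient of \<open>?p\<close> is bounded by a multiple of a
      vanishing coefficient of \<open>?q\<close>.\<close>
    have "((\<lambda>x. norm (poly ?p (of_real x) / of_real x ^ n)) \<longlongrightarrow> norm (coeff ?p n)) at_top"
      by (intro tendsto_norm filterlim_compose[OF poly_div_power_tendsto inf]) (simp add: n_def)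
    moreover have "((\<lambda>x. C * norm (poly ?q (of_real x) / of_real x ^ n)) \<longlongrightarrow> C * norm (coeff ?q n)) at_top"
      by (intro tendsto_mult tendsto_const tendsto_norm filterlim_compose[OF poly_div_power_tendsto inf])
         (use q in simp)
    moreover have "\<forall>\<^sub>F x in at_top. norm (poly ?p (of_real x) / of_real x ^ n)
        \<le> C * norm (poly ?q (of_real x) / of_real x ^ n)"
    proof -
      have "finite (Re ` (X \<union> rpoles r))" using fin by simp
      then obtain b where b: "\<And>x. x \<in> Re ` (X \<union> rpoles r) \<Longrightarrow> x \<le> b"
        using bdd_above_finite bdd_above.E by metis
      show ?thesis
        using eventually_gt_at_top[of b] eventually_gt_at_top[of 0]
      proof eventually_elim
        case (elim x)
        have "complex_of_real x \<notin> X \<union> rpoles r"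
          using b[of x] elim by (metis Re_complex_of_real image_eqI not_le)
        then have "norm (poly ?p (of_real x)) \<le> C * norm (poly ?q (of_real x))"
          using elim by (intro bd') auto
        then show ?case
          using elim by (simp add: norm_divide norm_power divide_right_mono)
      qed
    qed
    ultimately have "norm (coeff ?p n) \<le> C * norm (coeff ?q n)"
      by (intro tendsto_le[OF trivial_limit_at_top_linorder])
    also have "coeff ?q n = 0" using q by (rule coeff_eq_0)
    finally have "?p = 0" by (simp add: n_def)
    then have "rnum r = 0" by (simp add: map_poly_of_real_eq_0_iff)
    then show False using less by simp
  qed
  show "\<forall>z\<in>rpoles r. Re z < 0"
  proof (rule ballI, rule ccontr)
    fix z assume z: "z \<in> rpoles r" "\<not> Re z < 0"
    \<comment> \<open>Approaching \<open>z\<close> horizontally from the right stays in the open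
      half-plane even when \<open>z\<close> lies on the imaginary axis.\<close>
    have lim: "((\<lambda>t::real. z + of_real t) \<longlongrightarrow> z) (at_right 0)"
      by (auto intro!: tendsto_eq_intros)
    have inj: "inj (\<lambda>t::real. z + of_real t)" by (auto intro: injI)
    have "((\<lambda>t. norm (poly ?p (z + of_real t))) \<longlongrightarrow> norm (poly ?p z)) (at_right (0::real))"
      by (intro tendsto_norm tendsto_poly lim)
    moreover have "((\<lambda>t. C * norm (poly ?q (z + of_real t))) \<longlongrightarrow> C * norm (poly ?q z)) (at_right (0::real))"
      by (intro tendsto_mult tendsto_const tendsto_norm tendsto_poly lim)
    moreover have "\<forall>\<^sub>F t in at_right (0::real). norm (poly ?p (z + of_real t)) \<le> C * norm (poly ?q (z + of_real t))"
    proof -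
      have "finite ((\<lambda>t::real. z + of_real t) -` (X \<union> rpoles r))"
        by (intro finite_vimageI fin inj)
      then have "\<not> 0 islimpt (\<lambda>t::real. z + of_real t) -` (X \<union> rpoles r)"
        by (rule islimpt_finite)
      then have "\<forall>\<^sub>F t in at (0::real). t \<notin> (\<lambda>t. z + of_real t) -` (X \<union> rpoles r)"
        by (simp add: islimpt_iff_eventually)
      then have "\<forall>\<^sub>F t in at_right (0::real). t \<notin> (\<lambda>t. z + of_real t) -` (X \<union> rpoles r)"
        by (rule filter_leD[OF at_le[OF subset_UNIV]])
      then show ?thesis
        using eventually_at_right_less[of 0]
      proof eventually_elim
        case (elim t)
        then show ?case using z by (intro bd') auto
      qed
    qed
    ultimately have "norm (poly ?p z) \<le> C * norm (poly ?q z)"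
      by (intro tendsto_le[OF trivial_limit_at_right_real])
    moreover have q0: "poly ?q z = 0" using z by (simp add: rpoles_def)
    ultimately have p0: "poly ?p z = 0" by simp
    \<comment> \<open>The limit makes \<open>z\<close> a root of the numerator as well; a Bezout
      identity for the coprime pair rules out a common root.\<close>
    define a b where "a = fst (bezout_coefficients (rnum r) (rden r))"
      and "b = snd (bezout_coefficients (rnum r) (rden r))"
    have "gcd (rnum r) (rden r) = 1"
      using coprime_quot_of_fract[of r] by (simp add: rnum_def rden_def)
    then have "a * rnum r + b * rden r = 1"
      using bezout_coefficients_fst_snd[of "rnum r" "rden r"] by (simp add: a_def b_def)
    then have "cval (a * rnum r + b * rden r) z = 1" by simp
    then have "cval a z * cval (rnum r) z + cval b z * cval (rden r) z = 1"
      by (simp only: cval_add cval_mult)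
    then show False using p0 q0 by simp
  qed
qed


section \<open>The maximum principle in the right half-plane\<close>

text \<open>A Phragmen-Lindelof argument: division by \<open>1 + e * z\<close>, of modulus at least
  1 on the closed half-plane, keeps the bound on the axis and forces decay at infinity. The maximum
  modulus principle on a large half-disc then applies, and \<open>e\<close> tends to 0.\<close>

lemma half_plane_maximum_principle:
  assumes holo: "f holomorphic_on {z. 0 < Re z}"
    and cont: "continuous_on {z. 0 \<le> Re z} f"
    and bdd: "\<And>z. 0 \<le> Re z \<Longrightarrow> norm (f z) \<le> C"
    and axis: "\<And>w. norm (f (\<i> * complex_of_real w)) \<le> c"
    and z: "0 < Re z"
  shows "norm (f z) \<le> c"
proof -
  have c0: "0 \<le> c" using axis[of 0] norm_ge_zero order_trans by blast
  have C0: "0 \<le> C" using order_trans[OF norm_ge_zero bdd[of 0]] by simp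
  have aux: "norm (f z) \<le> c * norm (1 + of_real e * z)" if e: "0 < e" for e :: real
  proof -
    have one_le: "1 \<le> norm (1 + of_real e * w)" if "0 \<le> Re w" for w
    proof -
      have "1 \<le> Re (1 + of_real e * w)" using e that by simp
      also have "\<dots> \<le> norm (1 + of_real e * w)" by (rule complex_Re_le_cmod)
      finally show ?thesis .
    qed
    have nz: "1 + of_real e * w \<noteq> 0" if "0 \<le> Re w" for w
      using one_le[OF that] by (metis norm_zero not_one_le_zero)
    define g where "g w = f w / (1 + of_real e * w)" for w
    have le: "norm (g z) \<le> c + \<delta>" if \<delta>: "0 < \<delta>" for \<delta>
    proof -
      \<comment> \<open>The radius puts \<open>z\<close> inside the half-disc and ensures
        \<open>e * R - 1 \<ge> C / \<delta>\<close>, so \<open>g\<close> is at most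
        \<open>\<delta>\<close> in modulus on the arc.\<close>
      define R where "R = norm z + 1 + (C / \<delta> + 1) / e"
      have "0 < (C / \<delta> + 1) / e" using C0 \<delta> e by (simp add: add_nonneg_pos)
      then have Rz: "norm z < R" by (simp add: R_def)
      define S where "S = {w. 0 < Re w} \<inter> ball 0 R"
      have S_open: "open S"
        unfolding S_def by (intro open_Int open_halfspace_Re_gt open_ball)
      have clos: "closure S \<subseteq> {w. 0 \<le> Re w} \<inter> cball 0 R"
        by (rule closure_minimal)
           (auto simp: S_def intro!: closed_Int closed_halfspace_Re_ge)
      have front: "Re w = 0 \<or> norm w = R" "0 \<le> Re w" if "w \<in> frontier S" for w
      proof -
        have "w \<in> closure S" "w \<notin> S"
          using that S_open by (auto simp: frontier_def interior_open)
        then show "Re w = 0 \<or> norm w = R" "0 \<le> Re w"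
          using clos by (auto simp: S_def not_less)
      qed
      show ?thesis
      proof (rule maximum_modulus_frontier[of g S])
        have "g holomorphic_on S"
          unfolding g_def
          by (intro holomorphic_intros holomorphic_on_subset[OF holo] nz) (auto simp: S_def)
        then show "g holomorphic_on interior S" using S_open by (simp add: interior_open)
        show "continuous_on (closure S) g"
          unfolding g_def using clos
          by (intro continuous_intros continuous_on_subset[OF cont] ballI nz) auto
        show "bounded S" by (simp add: S_def bounded_Int)
        show "z \<in> S" using z Rz by (simp add: S_def)
        fix w assume w: "w \<in> frontier S"
        have w0: "0 \<le> Re w" by (rule front[OF w])
        from front(1)[OF w] show "norm (g w) \<le> c + \<delta>"
        proof
          assume "Re w = 0"
          then have "w = \<i> * complex_of_real (Im w)" by (simp add: complex_eq_iff)
          then have "norm (f w) \<le> c" using axis[of "Im w"] by simp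
          moreover have "norm (g w) \<le> norm (f w)"
            unfolding g_def norm_divide using one_le[OF w0]
            by (simp add: divide_le_eq mult_left_le_one_le mult_le_cancel_left1)
          ultimately show ?thesis using \<delta> by simp
        next
          assume "norm w = R"
          then have "e * R - 1 \<le> norm (1 + of_real e * w)"
            using norm_triangle_ineq2[of "of_real e * w" "-1"] e
            by (simp add: norm_mult add.commute)
          moreover have "C / \<delta> \<le> e * R - 1"
            using e by (simp add: R_def field_simps)
          ultimately have "C / \<delta> \<le> norm (1 + of_real e * w)" by simp
          then have "C \<le> \<delta> * norm (1 + of_real e * w)" using \<delta> by (simp add: field_simps)
          then have "norm (f w) \<le> \<delta> * norm (1 + of_real e * w)" using bdd[OF w0] by simp
          then have "norm (g w) \<le> \<delta>"
            unfolding g_def norm_divide using one_le[OF w0] \<delta> by (simp add: divide_le_eq)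
          then show ?thesis using c0 by simp
        qed
      qed
    qed
    have "norm (g z) \<le> c" by (rule field_le_epsilon) (rule le)
    then show ?thesis
      unfolding g_def norm_divide using one_le[of z] nz[of z] z by (simp add: divide_le_eq)
  qed
  have "((\<lambda>e. c * norm (1 + of_real e * z)) \<longlongrightarrow> c * norm (1 + of_real 0 * z)) (at_right 0)"
    by (intro tendsto_intros)
  moreover have "\<forall>\<^sub>F e in at_right 0. norm (f z) \<le> c * norm (1 + of_real e * z)"
    using eventually_at_right_less[of 0] by eventually_elim (rule aux)
  ultimately have "norm (f z) \<le> c * norm (1 + of_real 0 * z)"
    by (intro tendsto_lowerbound) auto
  then show ?thesis by simp
qed


section \<open>Self-adjoint operators and singular values\<close>

text \<open>A maximizer \<open>v\<close> of the Rayleigh quotient on the compact unit sphere is an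
  eigenvector: the form \<open>\<mu> * inner x x - inner x (T x)\<close> is nonnegative and vanishes
  at \<open>v\<close>, so its first variation there is zero. Varying in the direction of the
  residual \<open>w\<close> shows \<open>w = 0\<close>.\<close>

lemma selfadjoint_max_eigenvector:
  fixes T :: "'a::euclidean_space \<Rightarrow> 'a"
  assumes lin: "linear T" and sym: "\<And>x y. inner (T x) y = inner x (T y)"
  obtains v \<mu> where "v \<noteq> 0" "T v = \<mu> *\<^sub>R v" "\<And>x. inner x (T x) \<le> \<mu> * inner x x"
proof -
  let ?S = "sphere (0::'a) 1"
  have cont: "continuous_on ?S (\<lambda>x. inner x (T x))"
    by (intro continuous_intros linear_continuous_on) (simp add: lin linear_linear)
  have "?S \<noteq> {}" by simp
  then obtain v where v: "v \<in> ?S" and max: "\<And>y. y \<in> ?S \<Longrightarrow> inner y (T y) \<le> inner v (T v)"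
    using continuous_attains_sup[OF compact_sphere _ cont] by blast
  define \<mu> where "\<mu> = inner v (T v)"
  have vv: "inner v v = 1" using v by (simp add: dot_square_norm)
  have le: "inner x (T x) \<le> \<mu> * inner x x" for x
  proof (cases "x = 0")
    case True
    then show ?thesis by simp
  next
    case False
    define y where "y = x /\<^sub>R norm x"
    have "x = norm x *\<^sub>R y" using False by (simp add: y_def)
    then have "inner x (T x) = (norm x)\<^sup>2 * inner y (T y)"
      by (metis inner_scaleR_left inner_scaleR_right lin linear_scale mult.assoc power2_eq_square)
    also have "\<dots> \<le> (norm x)\<^sup>2 * \<mu>"
      unfolding \<mu>_def using False by (intro mult_left_mono max) (simp_all add: y_def)
    finally show ?thesis by (simp add: dot_square_norm mult.commute)
  qed
  define w where "w = \<mu> *\<^sub>R v - T v"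
  \<comment> \<open>Half the derivative of the form at \<open>v\<close> in direction
    \<open>w\<close> is exactly \<open>inner w w\<close>.\<close>
  have vw: "\<mu> * inner v w = inner v (T w) + inner w w"
    unfolding w_def using sym[of v v]
    by (simp add: inner_diff_left inner_diff_right linear_diff[OF lin] linear_scale[OF lin] sym
        inner_commute algebra_simps)
  have quad: "0 \<le> 2 * t * inner w w + t\<^sup>2 * (\<mu> * inner w w - inner w (T w))" for t :: real
  proof -
    have "0 \<le> \<mu> * inner (v + t *\<^sub>R w) (v + t *\<^sub>R w) - inner (v + t *\<^sub>R w) (T (v + t *\<^sub>R w))"
      using le[of "v + t *\<^sub>R w"] by simp
    also have "\<dots> = (\<mu> * inner v v - inner v (T v)) + 2 * t * (\<mu> * inner v w - inner v (T w))
        + t\<^sup>2 * (\<mu> * inner w w - inner w (T w))"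
      using sym[of w v]
      by (simp add: linear_add[OF lin] linear_scale[OF lin] inner_add_left inner_add_right
          inner_commute power2_eq_square algebra_simps)
    finally show ?thesis using vw vv by (simp add: \<mu>_def)
  qed
  have "w = 0"
  proof (rule ccontr)
    assume "w \<noteq> 0"
    then have pos: "0 < inner w w" by simp
    define K where "K = \<mu> * inner w w - inner w (T w)"
    have K: "0 \<le> K" using le[of w] by (simp add: K_def)
    \<comment> \<open>A negative step for which the linear term outweighs the quadratic one; the
      summand 1 covers \<open>K = 0\<close>.\<close>
    define t where "t = - (inner w w / (K + 1))"
    have "2 * t * inner w w + t\<^sup>2 * K = (inner w w)\<^sup>2 / (K + 1) * (K / (K + 1) - 2)"
      unfolding t_def using K by (simp add: power2_eq_square divide_simps) (simp add: algebra_simps)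
    moreover have "K / (K + 1) - 2 < 0" using K by (simp add: divide_less_eq)
    moreover have "0 < (inner w w)\<^sup>2 / (K + 1)" using K pos by (intro divide_pos_pos zero_less_power) auto
    ultimately have "2 * t * inner w w + t\<^sup>2 * K < 0" by (metis mult_pos_neg)
    then show False using quad[of t] by (simp add: K_def)
  qed
  then have "T v = \<mu> *\<^sub>R v" by (simp add: w_def)
  moreover have "v \<noteq> 0" using vv by auto
  ultimately show ?thesis using that le by blast
qed

text \<open>Eigenvectors for distinct eigenvalues are orthogonal, hence independent, and the
  dimension is finite. Finiteness gives meaning to the \<open>Max\<close> in
  \<open>max_singular_value\<close>.\<close>

lemma selfadjoint_finite_eigenvalues:
  fixes T :: "'a::euclidean_space \<Rightarrow> 'a"
  assumes sym: "\<And>x y. inner (T x) y = inner x (T y)"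
  shows "finite {\<mu>. \<exists>v. v \<noteq> 0 \<and> T v = \<mu> *\<^sub>R v}" (is "finite ?E")
proof -
  define f where "f \<mu> = (SOME v. v \<noteq> 0 \<and> T v = \<mu> *\<^sub>R v)" for \<mu>
  have f: "f \<mu> \<noteq> 0 \<and> T (f \<mu>) = \<mu> *\<^sub>R f \<mu>" if "\<mu> \<in> ?E" for \<mu>
    unfolding f_def by (rule someI_ex) (use that in simp)
  have orth: "inner (f \<mu>) (f \<nu>) = 0" if "\<mu> \<in> ?E" "\<nu> \<in> ?E" "\<mu> \<noteq> \<nu>" for \<mu> \<nu>
  proof -
    have "\<mu> * inner (f \<mu>) (f \<nu>) = \<nu> * inner (f \<mu>) (f \<nu>)"
      using sym[of "f \<mu>" "f \<nu>"] f that by simp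
    then show ?thesis using that by simp
  qed
  have inj: "inj_on f ?E"
  proof (rule inj_onI, rule ccontr)
    fix \<mu> \<nu> assume *: "\<mu> \<in> ?E" "\<nu> \<in> ?E" "f \<mu> = f \<nu>" "\<mu> \<noteq> \<nu>"
    then have "inner (f \<mu>) (f \<mu>) = 0" using orth[of \<mu> \<nu>] by simp
    then show False using f[OF *(1)] by simp
  qed
  have "pairwise orthogonal (f ` ?E)"
    unfolding pairwise_def orthogonal_def using orth by blast
  then have "independent (f ` ?E)"
    by (rule pairwise_orthogonal_independent) (use f in fastforce)
  then have "finite (f ` ?E)" by (rule independent_imp_finite)
  then show ?thesis using inj by (rule finite_imageD)
qed

text \<open>Here \<open>inner\<close> is the real part of the Hermitian product. With complex
  vectors viewed as a real Euclidean space, the preceding results on self-adjoint maps apply to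
  \<open>mat_adjoint A ** A\<close>.\<close>

lemma inner_mat_adjoint:
  fixes A :: "complex^'n^'m"
  shows "inner (mat_adjoint A *v y) x = inner y (A *v x)"
proof -
  have "inner (mat_adjoint A *v y) x = (\<Sum>j\<in>UNIV. \<Sum>i\<in>UNIV. Re (cnj (y $ i) * (A $ i $ j * x $ j)))"
    by (simp add: inner_vec_def matrix_vector_mult_def mat_adjoint_def transpose_def inner_complex_def
        sum_distrib_right flip: Re_sum sum.distrib)
       (auto simp: algebra_simps sum_distrib_left sum.distrib sum_subtractf intro!: sum.cong)
  also have "\<dots> = (\<Sum>i\<in>UNIV. \<Sum>j\<in>UNIV. Re (cnj (y $ i) * (A $ i $ j * x $ j)))"
    by (rule sum.swap)
  also have "\<dots> = inner y (A *v x)"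
    by (simp add: inner_vec_def matrix_vector_mult_def inner_complex_def
        algebra_simps sum_distrib_left sum.distrib sum_subtractf)
  finally show ?thesis .
qed

lemma scaleR_eq_vector_scale: "r *\<^sub>R (v :: complex^'n) = complex_of_real r *s v"
  by (simp add: vec_eq_iff scaleR_conv_of_real[where 'a = complex])

text \<open>The square root of the top eigenvalue \<open>\<mu>\<close> of
  \<open>mat_adjoint A ** A\<close> is a singular value, and the squared norm of
  \<open>A *v x\<close> is the quadratic form of that matrix, at most \<open>\<mu>\<close> times the
  squared norm of \<open>x\<close>.\<close>

lemma norm_le_max_singular_value:
  fixes A :: "complex^'n^'m"
  shows "norm (A *v x) \<le> max_singular_value A * norm x"
proof -
  define T where "T x = mat_adjoint A ** A *v x" for x
  have inner_T: "inner (T x) y = inner (A *v x) (A *v y)" for x y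
    by (simp add: T_def inner_mat_adjoint flip: matrix_vector_mul_assoc)
  have sym: "inner (T x) y = inner x (T y)" for x y
    by (metis inner_T inner_commute)
  have lin: "linear T"
    by (rule linearI)
       (simp_all add: T_def matrix_vector_right_distrib scaleR_eq_vector_scale vector_scalar_commute)
  have eig: "mat_eigenvalue (mat_adjoint A ** A) (complex_of_real \<mu>) \<longleftrightarrow> (\<exists>v. v \<noteq> 0 \<and> T v = \<mu> *\<^sub>R v)" for \<mu>
    by (simp add: mat_eigenvalue_def T_def scaleR_eq_vector_scale)
  obtain v \<mu> where v: "v \<noteq> 0" "T v = \<mu> *\<^sub>R v" and le: "\<And>x. inner x (T x) \<le> \<mu> * inner x x"
    using selfadjoint_max_eigenvector[OF lin sym] by blast
  have "\<mu> * inner v v = inner (A *v v) (A *v v)"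
    using inner_T[of v v] v by simp
  then have \<mu>: "0 \<le> \<mu>"
    using v(1) by (metis inner_ge_zero inner_gt_zero_iff mult_less_0_iff not_less)
  let ?E = "{\<mu>. \<exists>v. v \<noteq> 0 \<and> T v = \<mu> *\<^sub>R v}"
  have "{s. 0 \<le> s \<and> s\<^sup>2 \<in> ?E} \<subseteq> sqrt ` ?E"
  proof
    fix s assume "s \<in> {s. 0 \<le> s \<and> s\<^sup>2 \<in> ?E}"
    then have "s = sqrt (s\<^sup>2)" "s\<^sup>2 \<in> ?E" by simp_all
    then show "s \<in> sqrt ` ?E" by (rule image_eqI)
  qed
  then have "finite {s. 0 \<le> s \<and> s\<^sup>2 \<in> ?E}"
    using selfadjoint_finite_eigenvalues[OF sym] finite_surj by blast
  then have fin: "finite {s. singular_value A s}"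
    by (simp add: singular_value_def eig flip: of_real_power)
  have "singular_value A (sqrt \<mu>)"
    using \<mu> v by (auto simp: singular_value_def eig simp flip: of_real_power)
  then have "sqrt \<mu> \<le> max_singular_value A"
    unfolding max_singular_value_def using fin by simp
  moreover have "norm (A *v x) \<le> sqrt \<mu> * norm x"
  proof (rule power2_le_imp_le)
    show "(norm (A *v x))\<^sup>2 \<le> (sqrt \<mu> * norm x)\<^sup>2"
      using le[of x] \<mu> inner_T[of x x]
      by (simp add: power_mult_distrib power2_norm_eq_inner inner_commute)
  qed (use \<mu> in simp)
  ultimately show ?thesis
    by (meson mult_right_mono norm_ge_zero order_trans)
qed

text \<open>The maximal eigenvector of \<open>- Q\<close> is a minimal one of
  \<open>Q\<close>.\<close>

lemma symmetric_min_eigenvalue: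
  fixes Q :: "real^'n^'n"
  assumes sym: "transpose Q = Q" and min: "\<And>\<mu>. mat_eigenvalue Q \<mu> \<Longrightarrow> l \<le> \<mu>"
  shows "l * inner x x \<le> inner x (Q *v x)"
proof -
  define T where "T x = - (Q *v x)" for x
  have lin: "linear T"
    by (rule linearI) (simp_all add: T_def matrix_vector_right_distrib matrix_vector_mult_scaleR)
  have selfadj: "inner (T x) y = inner x (T y)" for x y
    using dot_lmul_matrix[of x Q y] transpose_matrix_vector[of Q x]
    by (simp add: T_def sym)
  obtain v \<mu> where v: "v \<noteq> 0" "T v = \<mu> *\<^sub>R v" and le: "\<And>x. inner x (T x) \<le> \<mu> * inner x x"
    using selfadjoint_max_eigenvector[OF lin selfadj] by blast
  have "Q *v v = (- \<mu>) *s v"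
    using v(2) by (simp add: T_def vec_eq_iff) (metis minus_equation_iff)
  then have "l \<le> - \<mu>" using v(1) by (intro min) (auto simp: mat_eigenvalue_def)
  then have "l * inner x x \<le> - \<mu> * inner x x" by (intro mult_right_mono) auto
  then show ?thesis using le[of x] by (simp add: T_def)
qed


section \<open>Transfer matrices\<close>

definition mpoles :: "ratfun^'n^'m \<Rightarrow> complex set"
  where "mpoles M = (\<Union>i. \<Union>j. rpoles (M $ i $ j))"

lemma finite_mpoles: "finite (mpoles M)"
  by (simp add: mpoles_def finite_rpoles)

lemma meval_mult:
  assumes "z \<notin> mpoles A" "z \<notin> mpoles B"
  shows "meval (A ** B) z = meval A z ** meval B z"
  using assms
  by (simp add: vec_eq_iff meval_def matrix_matrix_mult_def mpoles_def reval_sum reval_mult)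

lemma meval_diff:
  assumes "z \<notin> mpoles A" "z \<notin> mpoles B"
  shows "meval (A - B) z = meval A z - meval B z" and "z \<notin> mpoles (A - B)"
proof -
  have nz: "z \<notin> rpoles (A $ i $ j)" "z \<notin> rpoles (- (B $ i $ j))" for i j
    using assms by (simp_all add: mpoles_def reval_uminus(1))
  have "reval (A $ i $ j - B $ i $ j) z = reval (A $ i $ j) z - reval (B $ i $ j) z" for i j
    using reval_add(2)[OF nz] assms(2) by (simp add: mpoles_def reval_uminus)
  then show "meval (A - B) z = meval A z - meval B z"
    by (simp add: vec_eq_iff meval_def)
  show "z \<notin> mpoles (A - B)"
    using reval_add(1)[OF nz] by (simp add: mpoles_def)
qed

lemma proper_stable_mpoles:
  assumes "proper_stable M" "0 \<le> Re z"
  shows "z \<notin> mpoles M"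
  using assms by (fastforce simp: proper_stable_def mpoles_def)

lemma meval_bound_imp_proper_stable:
  assumes "finite X" and "\<And>z i j. 0 < Re z \<Longrightarrow> z \<notin> X \<Longrightarrow> norm (meval M z $ i $ j) \<le> C"
  shows "proper_stable M"
  unfolding proper_stable_def
  using bounded_imp_proper_stable[OF assms(1), of "M $ i $ j" C for i j] assms(2)
  by (simp add: meval_def)

text \<open>Passing to moduli reduces this to the real Cauchy-Schwarz inequality. The modulus of the
  Hermitian product is bounded, not just its real part \<open>inner u v\<close>.\<close>

lemma norm_sum_cnj_le:
  fixes u v :: "complex^'n"
  shows "norm (\<Sum>i\<in>UNIV. cnj (u $ i) * v $ i) \<le> norm u * norm v"
proof -
  have "norm (\<Sum>i\<in>UNIV. cnj (u $ i) * v $ i) \<le> (\<Sum>i\<in>UNIV. \<bar>norm (u $ i)\<bar> * \<bar>norm (v $ i)\<bar>)"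
    by (rule sum_norm_le) (simp add: norm_mult)
  also have "\<dots> \<le> norm u * norm v"
    unfolding norm_vec_def by (rule L2_set_mult_ineq)
  finally show ?thesis .
qed

text \<open>The maximum principle is applied to the scalar function \<open>z \<mapsto> \<langle>G(z\<^sub>0)x, G(z)x\<rangle>\<close>, whose value at
  \<open>z\<^sub>0\<close> is \<open>\<parallel>G(z\<^sub>0)x\<parallel>\<^sup>2\<close>.\<close>

lemma stable_half_plane_bound:
  fixes G :: "ratfun^'n^'m"
  assumes stable: "proper_stable G"
    and axis: "\<And>w. max_singular_value (meval G (\<i> * complex_of_real w)) \<le> c"
    and z0: "0 < Re z0"
  shows "norm (meval G z0 *v x) \<le> c * norm x"
proof -
  define u where "u = meval G z0 *v x"
  \<comment> \<open>Only the fixed vector \<open>u\<close> is conjugated, so \<open>f\<close> stays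
    holomorphic in \<open>z\<close>.\<close>
  define f where "f z = (\<Sum>i\<in>UNIV. cnj (u $ i) * (meval G z *v x) $ i)" for z
  have f_eq: "f z = (\<Sum>i\<in>UNIV. cnj (u $ i) * (\<Sum>j\<in>UNIV. reval (G $ i $ j) z * x $ j))" for z
    by (simp add: f_def matrix_vector_mult_def meval_def)
  have nz: "cval (rden (G $ i $ j)) z \<noteq> 0" if "0 \<le> Re z" for i j z
    using proper_stable_mpoles[OF stable that] by (auto simp: mpoles_def rpoles_def)
  obtain C where C: "\<And>i j z. 0 \<le> Re z \<Longrightarrow> norm (reval (G $ i $ j) z) \<le> C i j"
  proof -
    have "\<exists>C. \<forall>z. 0 \<le> Re z \<longrightarrow> norm (reval (G $ i $ j) z) \<le> C" for i j
      using stable by (intro proper_stable_bounded) (auto simp: proper_stable_def)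
    then show ?thesis using that by metis
  qed
  have "norm (f z0) \<le> norm u * (c * norm x)"
  proof (rule half_plane_maximum_principle[OF _ _ _ _ z0])
    show "f holomorphic_on {z. 0 < Re z}"
      unfolding f_eq reval_def by (intro holomorphic_intros) (auto simp: nz)
    show "continuous_on {z. 0 \<le> Re z} f"
      unfolding f_eq reval_def by (intro continuous_intros) (auto simp: nz)
    show "norm (f z) \<le> (\<Sum>i\<in>UNIV. norm (u $ i) * (\<Sum>j\<in>UNIV. C i j * norm (x $ j)))"
      if "0 \<le> Re z" for z
      unfolding f_eq
    proof (intro sum_norm_le)
      fix i
      have "norm (\<Sum>j\<in>UNIV. reval (G $ i $ j) z * x $ j) \<le> (\<Sum>j\<in>UNIV. C i j * norm (x $ j))"
        by (intro sum_norm_le) (simp add: norm_mult mult_right_mono C that)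
      then show "norm (cnj (u $ i) * (\<Sum>j\<in>UNIV. reval (G $ i $ j) z * x $ j))
          \<le> norm (u $ i) * (\<Sum>j\<in>UNIV. C i j * norm (x $ j))"
        by (simp add: norm_mult mult_left_mono)
    qed
    show "norm (f (\<i> * complex_of_real w)) \<le> norm u * (c * norm x)" for w
    proof -
      let ?G = "meval G (\<i> * complex_of_real w)"
      have "norm (?G *v x) \<le> c * norm x"
        using norm_le_max_singular_value[of ?G x] mult_right_mono[OF axis[of w], of "norm x"] by simp
      then show ?thesis
        unfolding f_def using norm_sum_cnj_le[of u "?G *v x"]
        by (meson mult_left_mono norm_ge_zero order_trans)
    qed
  qed
  moreover have "f z0 = of_real ((norm u)\<^sup>2)"
    by (simp add: f_def power2_norm_eq_inner inner_vec_def complex_norm_square[symmetric]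
        mult.commute[of "cnj _"] flip: u_def)
  ultimately have "(norm u)\<^sup>2 \<le> norm u * (c * norm x)"
    by (metis abs_power2 norm_of_real)
  then have "norm u \<le> c * norm x \<or> norm u = 0"
    by (simp add: power2_eq_square mult_le_cancel_left) linarith
  \<comment> \<open>This settles the case \<open>norm u = 0\<close>; the sign of \<open>c\<close> is
    not assumed but follows from the bound at frequency 0.\<close>
  moreover have "0 \<le> c * norm x"
    using norm_le_max_singular_value[of "meval G (\<i> * complex_of_real 0)" x]
      mult_right_mono[OF axis[of 0], of "norm x"] by (meson norm_ge_zero order_trans)
  ultimately show ?thesis unfolding u_def by auto
qed

lemma hinf_norm_less_imp:
  assumes "hinf_norm G < ereal c"
  shows "proper_stable G" and "max_singular_value (meval G (\<i> * complex_of_real w)) \<le> c"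
proof -
  show st: "proper_stable G" using assms by (auto simp: hinf_norm_def split: if_splits)
  have "ereal (max_singular_value (meval G (\<i> * complex_of_real w))) \<le> hinf_norm G"
    unfolding hinf_norm_def using st by (auto intro: SUP_upper)
  then show "max_singular_value (meval G (\<i> * complex_of_real w)) \<le> c"
    using assms by (metis ereal_less_eq(3) less_imp_le order_trans)
qed


section \<open>Kronecker products and block diagonal matrices\<close>

lemma sum_UNIV_prod:
  "(\<Sum>p\<in>UNIV. f p) = (\<Sum>i\<in>UNIV. \<Sum>k\<in>UNIV. f (i, k))"
  by (simp add: sum.cartesian_product UNIV_Times_UNIV[symmetric] del: UNIV_Times_UNIV)

text \<open>The mixed-product rule: the sum over a pair index factors into two sums.\<close>

lemma kronecker_mult:
  fixes A :: "'a::comm_semiring_1^'n^'m" and C :: "'a^'l^'n"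
    and B :: "'a^'q^'p" and D :: "'a^'r^'q"
  shows "(A \<otimes>\<^sub>K B) ** (C \<otimes>\<^sub>K D) = (A ** C) \<otimes>\<^sub>K (B ** D)"
  by (simp add: vec_eq_iff kronecker_def matrix_matrix_mult_def sum_UNIV_prod sum_product mult.commute mult.left_commute mult.assoc)

lemma kronecker_one: "(mat 1 :: 'a::semiring_1^'n^'n) \<otimes>\<^sub>K (mat 1 :: 'a^'q^'q) = mat 1"
  by (auto simp: vec_eq_iff kronecker_def mat_def prod_eq_iff)

lemma kronecker_one_left: "mat 1 \<otimes>\<^sub>K B = block_diag (\<lambda>_. B :: 'a::semiring_1^'q^'p)"
  by (auto simp: vec_eq_iff kronecker_def mat_def block_diag_def)

lemma block_diag_mult:
  fixes A :: "'n::finite \<Rightarrow> 'a::semiring_1^'q^'p" and B :: "'n \<Rightarrow> 'a^'r^'q"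
  shows "block_diag A ** block_diag B = block_diag (\<lambda>i. A i ** B i)"
proof -
  have key: "(\<Sum>i'\<in>UNIV. \<Sum>k\<in>UNIV. (if i = i' then A i $ l $ k else 0) * (if i' = j then B i' $ k $ m else 0))
      = (if i = j then \<Sum>k\<in>UNIV. A i $ l $ k * B i $ k $ m else 0)" for i j l m
  proof -
    have "(\<Sum>i'\<in>UNIV. \<Sum>k\<in>UNIV. (if i = i' then A i $ l $ k else 0) * (if i' = j then B i' $ k $ m else 0))
      = (\<Sum>i'\<in>UNIV. if i = i' then (if i = j then \<Sum>k\<in>UNIV. A i $ l $ k * B i $ k $ m else 0) else 0)"
      by (intro sum.cong) auto
    then show ?thesis by simp
  qed
  then show ?thesis
    unfolding vec_eq_iff block_diag_def matrix_matrix_mult_def sum_UNIV_prod vec_lambda_beta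
      fst_conv snd_conv key by simp
qed

lemma rconst_sum: "rconst (sum f S) = (\<Sum>x\<in>S. rconst (f x))"
  by (induction S rule: infinite_finite_induct) simp_all

lemma map_matrix_rconst_mult:
  "map_matrix rconst (A ** B) = map_matrix rconst A ** map_matrix rconst B"
  by (simp add: vec_eq_iff matrix_matrix_mult_def rconst_sum)

lemma map_matrix_rconst_one: "map_matrix rconst (mat 1) = mat 1"
  by (simp add: vec_eq_iff mat_def)

lemma matrix_inv_mult:
  assumes "invertible A"
  shows "A ** matrix_inv A = mat 1" and "matrix_inv A ** A = mat 1"
proof -
  have "A ** matrix_inv A = mat 1 \<and> matrix_inv A ** A = mat 1"
    unfolding matrix_inv_def by (rule someI_ex) (use assms in \<open>simp add: invertible_def\<close>)
  then show "A ** matrix_inv A = mat 1" and "matrix_inv A ** A = mat 1" by auto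
qed

lemma matrix_inv_unique':
  assumes "A ** B = mat 1" "B ** A = mat 1"
  shows "matrix_inv A = B"
proof -
  have "invertible A" using assms by (auto simp: invertible_def)
  then show ?thesis
    by (metis assms(2) matrix_inv_mult(1) matrix_mul_assoc matrix_mul_lid matrix_mul_rid)
qed

lemma norm_vec_prod:
  fixes x :: "complex^('n::finite \<times> 'q::finite)"
  shows "(norm x)\<^sup>2 = (\<Sum>i\<in>UNIV. (norm (\<chi> k. x $ (i, k)))\<^sup>2)"
  by (simp add: power2_norm_eq_inner inner_vec_def sum_UNIV_prod)

text \<open>Each block acts on its own part of \<open>x\<close>, and squared norms add over the
  blocks.\<close>

lemma norm_block_diag_le:
  fixes A :: "'n::finite \<Rightarrow> complex^'q^'p"
  assumes c: "0 \<le> c" and le: "\<And>i x. norm (A i *v x) \<le> c * norm x"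
  shows "norm (block_diag A *v x) \<le> c * norm x"
proof (rule power2_le_imp_le)
  have comp: "(\<chi> k. (block_diag A *v x) $ (i, k)) = A i *v (\<chi> k. x $ (i, k))" for i
  proof -
    have "(\<Sum>j\<in>UNIV. \<Sum>l\<in>UNIV. (if i = j then A i $ k $ l else 0) * x $ (j, l))
        = (\<Sum>j\<in>UNIV. if i = j then \<Sum>l\<in>UNIV. A i $ k $ l * x $ (i, l) else 0)" for k
      by (intro sum.cong) auto
    then show ?thesis
      unfolding vec_eq_iff block_diag_def matrix_vector_mult_def sum_UNIV_prod vec_lambda_beta
        fst_conv snd_conv by simp
  qed
  have "(norm (block_diag A *v x))\<^sup>2 = (\<Sum>i\<in>UNIV. (norm (A i *v (\<chi> k. x $ (i, k))))\<^sup>2)"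
    by (simp add: norm_vec_prod[of "block_diag A *v x"] comp)
  also have "\<dots> \<le> (\<Sum>i\<in>UNIV. (c * norm (\<chi> k. x $ (i, k)))\<^sup>2)"
    by (intro sum_mono power_mono le) simp
  also have "\<dots> = (c * norm x)\<^sup>2"
    by (simp add: power_mult_distrib norm_vec_prod[of x] sum_distrib_left)
  finally show "(norm (block_diag A *v x))\<^sup>2 \<le> (c * norm x)\<^sup>2" .
qed (use c in simp)

text \<open>On each dq-component the real and imaginary parts decouple, so the Rayleigh bound for the real
  matrix \<open>Q\<close> carries over to complex vectors.\<close>

lemma norm_kronecker_ge:
  fixes Q :: "real^'n^'n" and x :: "complex^('n \<times> 'q::finite)"
  assumes Q: "\<And>x. l * inner x x \<le> inner x (Q *v x)"
  shows "l * norm x \<le> norm ((map_matrix of_real Q \<otimes>\<^sub>K mat 1) *v x)"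
proof -
  define P :: "complex^('n \<times> 'q)^('n \<times> 'q)" where "P = map_matrix of_real Q \<otimes>\<^sub>K mat 1"
  define a b where "a k = (\<chi> i. Re (x $ (i, k)))" and "b k = (\<chi> i. Im (x $ (i, k)))" for k
  have Px: "(P *v x) $ (i, k) = (\<Sum>j\<in>UNIV. of_real (Q $ i $ j) * x $ (j, k))" for i k
  proof -
    have "(\<Sum>m\<in>UNIV. of_real (Q $ i $ j) * (if k = m then 1 else 0) * x $ (j, m))
        = (\<Sum>m\<in>UNIV. if k = m then of_real (Q $ i $ j) * x $ (j, k) else 0)" for j
      by (intro sum.cong) auto
    then show ?thesis
      by (simp add: P_def kronecker_def mat_def matrix_vector_mult_def sum_UNIV_prod)
  qed
  have re: "Re ((P *v x) $ (i, k)) = (Q *v a k) $ i" and im: "Im ((P *v x) $ (i, k)) = (Q *v b k) $ i" for i k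
    unfolding Px by (simp_all add: matrix_vector_mult_def a_def b_def)
  have swap: "inner x y = (\<Sum>k\<in>UNIV. \<Sum>i\<in>UNIV. Re (x $ (i, k)) * Re (y $ (i, k)) + Im (x $ (i, k)) * Im (y $ (i, k)))"
    for y :: "complex^('n \<times> 'q)"
    unfolding inner_vec_def sum_UNIV_prod inner_complex_def by (rule sum.swap)
  have "l * inner x x = (\<Sum>k\<in>UNIV. l * inner (a k) (a k) + l * inner (b k) (b k))"
    unfolding swap[of x]
    by (simp add: inner_vec_def a_def b_def sum.distrib sum_distrib_left distrib_left)
  also have "\<dots> \<le> (\<Sum>k\<in>UNIV. inner (a k) (Q *v a k) + inner (b k) (Q *v b k))"
    by (intro sum_mono add_mono Q)
  also have "\<dots> = inner x (P *v x)"
    unfolding swap[of "P *v x"] re im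
    by (simp add: inner_vec_def sum.distrib a_def b_def)
  \<comment> \<open>Cauchy-Schwarz turns the Rayleigh bound into a norm bound once a factor
    \<open>norm x\<close> is cancelled.\<close>
  also have "\<dots> \<le> norm x * norm (P *v x)" by (rule norm_cauchy_schwarz)
  finally have "norm x * (l * norm x) \<le> norm x * norm (P *v x)"
    by (simp add: dot_square_norm power2_eq_square mult.left_commute)
  then have "l * norm x \<le> norm (P *v x)"
    by (cases "x = 0") auto
  then show ?thesis by (simp add: P_def)
qed


section \<open>The closed loop\<close>

text \<open>The determinant is \<open>(s + \<tau>)\<^sup>2 + \<omega>0\<^sup>2\<close> over a
  nonzero square, and this polynomial takes the positive value \<open>\<omega>0\<^sup>2\<close> at
  \<open>s = - \<tau>\<close>.\<close>

lemma invertible_line_dynamics: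
  assumes "\<omega>0 > 0"
  shows "invertible (line_dynamics \<omega>0 \<tau>)"
proof -
  define d where "d = (rvar + rconst \<tau>)\<^sup>2 / rconst \<omega>0 + rconst \<omega>0"
  have w: "rconst \<omega>0 \<noteq> 0" using assms by (simp add: rconst_def)
  have num: "(rvar + rconst \<tau>)\<^sup>2 + (rconst \<omega>0)\<^sup>2 \<noteq> 0"
  proof
    assume "(rvar + rconst \<tau>)\<^sup>2 + (rconst \<omega>0)\<^sup>2 = 0"
    moreover have "(rvar + rconst \<tau>)\<^sup>2 + (rconst \<omega>0)\<^sup>2 = to_fract ([:\<tau>, 1:]\<^sup>2 + [:\<omega>0:]\<^sup>2)"
      by (simp add: rvar_def rconst_def power2_eq_square flip: to_fract_add to_fract_mult)
    ultimately have "[:\<tau>, 1:]\<^sup>2 + [:\<omega>0:]\<^sup>2 = 0" by (simp only: to_fract_eq_0_iff)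
    then have "poly ([:\<tau>, 1:]\<^sup>2 + [:\<omega>0:]\<^sup>2) (- \<tau>) = 0" by simp
    then show False using assms by simp
  qed
  have "d = ((rvar + rconst \<tau>)\<^sup>2 + (rconst \<omega>0)\<^sup>2) / rconst \<omega>0"
    using w by (simp add: d_def power2_eq_square add_divide_distrib)
  then have d: "d \<noteq> 0" using num w by simp
  have "det (line_dynamics \<omega>0 \<tau>) = ((rvar + rconst \<tau>)\<^sup>2 + (rconst \<omega>0)\<^sup>2) / d\<^sup>2"
    unfolding line_dynamics_def det_2 d_def[symmetric]
    using d by (simp add: vector_2 power2_eq_square divide_simps)
  then have "det (line_dynamics \<omega>0 \<tau>) \<noteq> 0" using num d by simp
  then show ?thesis by (simp add: invertible_det_nz)
qed

text \<open>The inverse of a Kronecker product is the product of the inverses, so multiplication by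
  \<open>Q\<close> tensor identity cancels the inverse of \<open>Q\<close> and leaves the inverse of
  \<open>F\<close> acting on every device block.\<close>

lemma open_loop_eq:
  assumes Q: "invertible Q" and F: "invertible F"
  shows "(map_matrix rconst Q \<otimes>\<^sub>K mat 1) ** (mat 1 + open_loop Q F Y)
    = map_matrix rconst Q \<otimes>\<^sub>K mat 1 - block_diag (\<lambda>i. matrix_inv F ** Y i)"
    and "invertible (map_matrix rconst Q \<otimes>\<^sub>K (mat 1 :: ratfun^2^2))"
proof -
  let ?Q = "map_matrix rconst Q" and ?R = "map_matrix rconst (matrix_inv Q)"
  have QR: "?Q ** ?R = mat 1" "?R ** ?Q = mat 1"
    using matrix_inv_mult[OF Q] by (simp_all add: map_matrix_rconst_one flip: map_matrix_rconst_mult)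
  note FF = matrix_inv_mult[OF F]
  have inv: "matrix_inv (network_admittance Q F) = ?R \<otimes>\<^sub>K matrix_inv F"
    unfolding network_admittance_def
    by (rule matrix_inv_unique') (simp_all add: kronecker_mult QR FF kronecker_one)
  have PR: "(?Q \<otimes>\<^sub>K mat 1) ** (?R \<otimes>\<^sub>K mat 1) = (mat 1 :: ratfun^('a \<times> 2)^('a \<times> 2))"
    "(?R \<otimes>\<^sub>K mat 1) ** (?Q \<otimes>\<^sub>K mat 1) = (mat 1 :: ratfun^('a \<times> 2)^('a \<times> 2))"
    by (simp_all add: kronecker_mult QR kronecker_one)
  then show "invertible (?Q \<otimes>\<^sub>K (mat 1 :: ratfun^2^2))"
    by (auto simp: invertible_def)
  have "(?Q \<otimes>\<^sub>K mat 1) ** (?R \<otimes>\<^sub>K matrix_inv F) = mat 1 \<otimes>\<^sub>K matrix_inv F"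
    by (simp add: kronecker_mult QR)
  then have "(?Q \<otimes>\<^sub>K mat 1) ** (matrix_inv (network_admittance Q F) ** block_diag Y)
      = block_diag (\<lambda>i. matrix_inv F ** Y i)"
    by (simp add: inv matrix_mul_assoc kronecker_one_left block_diag_mult)
  moreover have "A ** (- B) = - (A ** B)" for A B :: "ratfun^('a \<times> 2)^('a \<times> 2)"
    by (simp add: vec_eq_iff matrix_matrix_mult_def sum_negf)
  ultimately show "(?Q \<otimes>\<^sub>K mat 1) ** (mat 1 + open_loop Q F Y)
      = ?Q \<otimes>\<^sub>K mat 1 - block_diag (\<lambda>i. matrix_inv F ** Y i)"
    unfolding open_loop_def matrix_add_ldistrib by simp
qed

text \<open>The lower bound is applied to column \<open>j\<close> of \<open>M\<close>, which
  \<open>A\<close> maps to column \<open>j\<close> of \<open>A ** M\<close>.\<close>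

lemma column_norm_bound:
  fixes A :: "complex^'k^'k" and M :: "complex^'l^'k"
  assumes \<delta>: "0 < \<delta>" and ge: "\<And>x. \<delta> * norm x \<le> norm (A *v x)"
  shows "norm (M $ i $ j) \<le> norm (\<chi> r. (A ** M) $ r $ j) / \<delta>"
proof -
  have "A *v (\<chi> r. M $ r $ j) = (\<chi> r. (A ** M) $ r $ j)"
    by (simp add: vec_eq_iff matrix_vector_mult_def matrix_matrix_mult_def)
  then have "\<delta> * norm (\<chi> r. M $ r $ j) \<le> norm (\<chi> r. (A ** M) $ r $ j)"
    using ge[of "\<chi> r. M $ r $ j"] by simp
  moreover have "norm (M $ i $ j) \<le> norm (\<chi> r. M $ r $ j)"
    using Finite_Cartesian_Product.norm_nth_le[of "\<chi> r. M $ r $ j" i] by simp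
  ultimately have "\<delta> * norm (M $ i $ j) \<le> norm (\<chi> r. (A ** M) $ r $ j)"
    using \<delta> by (meson mult_left_mono less_imp_le order_trans)
  then show ?thesis
    using \<delta> by (simp add: pos_le_divide_eq mult.commute)
qed

text \<open>A nonzero kernel vector over the field of rational functions would have a nonzero value
  at some positive real point off the finite exceptional set, against the lower bound there.\<close>

lemma invertible_if_coercive:
  fixes A :: "ratfun^'k^'k"
  assumes \<delta>: "0 < \<delta>"
    and ge: "\<And>z x. 0 < Re z \<Longrightarrow> z \<notin> mpoles A \<Longrightarrow> \<delta> * norm x \<le> norm (meval A z *v x)"
  shows "invertible A"
proof -
  have "v = 0" if "A *v v = 0" for v
  proof (rule ccontr)
    assume "v \<noteq> 0"
    then obtain k where k: "v $ k \<noteq> 0" by (auto simp: vec_eq_iff)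
    \<comment> \<open>Repeating \<open>v\<close> as every column gives a matrix, to which
      \<open>meval_mult\<close> and \<open>column_norm_bound\<close> apply.\<close>
    define N :: "ratfun^'k^'k" where "N = (\<chi> i j. v $ i)"
    have AN: "A ** N = 0"
      using that by (simp add: vec_eq_iff N_def matrix_matrix_mult_def matrix_vector_mult_def)
    have "finite (mpoles A \<union> mpoles N \<union> {z. reval (v $ k) z = 0})" (is "finite ?X")
      by (simp add: finite_mpoles finite_reval_zeros k)
    moreover have "infinite ((of_real :: real \<Rightarrow> complex) ` {0<..})"
      by (simp add: finite_image_iff inj_on_def infinite_Ioi)
    ultimately have "\<not> (of_real :: real \<Rightarrow> complex) ` {0<..} \<subseteq> ?X"
      using finite_subset by blast
    then obtain t :: real where t: "0 < t" "of_real t \<notin> ?X" by auto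
    have "meval A (of_real t) ** meval N (of_real t) = meval 0 (of_real t)"
      using meval_mult[of "of_real t" A N] t by (simp add: AN)
    also have "\<dots> = 0" by (simp add: meval_def vec_eq_iff reval_0)
    finally have AN0: "meval A (of_real t) ** meval N (of_real t) = 0" .
    have "norm (meval N (of_real t) $ k $ k)
        \<le> norm (\<chi> r. (meval A (of_real t) ** meval N (of_real t)) $ r $ k) / \<delta>"
      using t by (intro column_norm_bound[OF \<delta>] ge) auto
    also have "\<dots> = 0" by (simp add: AN0 flip: zero_vec_def)
    finally have "reval (v $ k) (of_real t) = 0" by (simp add: meval_def N_def)
    then show False using t by simp
  qed
  then show ?thesis
    using invertible_left_inverse matrix_left_invertible_ker by blast
qed

theorem mainTheorem1:
  fixes \<omega>0 \<tau> lam1 :: real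
    and B :: "'n::finite \<Rightarrow> 'n \<Rightarrow> real"
    and Y :: "'n \<Rightarrow> ratfun^2^2"
    and Q :: "real^'n^'n"
    and F :: "ratfun^2^2"
  assumes "\<omega>0 > 0" and "\<tau> \<ge> 0"
    and "\<And>i j. B i j = B j i" and "\<And>i j. B i j \<ge> 0"
    and "Q = grounded_laplacian B"
    and "F = line_dynamics \<omega>0 \<tau>"
    and "lam1 > 0"
    and "mat_eigenvalue Q lam1" and "\<And>\<mu>. mat_eigenvalue Q \<mu> \<Longrightarrow> lam1 \<le> \<mu>"
    and "(MAX i. hinf_norm (matrix_inv F ** Y i)) < ereal lam1"
  shows "closed_loop_stable (open_loop Q F Y)"
proof -
  have "transpose Q = Q"
    by (simp add: assms(3) assms(5) vec_eq_iff transpose_def grounded_laplacian_def)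
  then have Q_ge: "lam1 * inner x x \<le> inner x (Q *v x)" for x
    by (rule symmetric_min_eigenvalue) (rule assms(9))
  have "x = 0" if "Q *v x = 0" for x
  proof -
    have "inner x x \<le> 0" using Q_ge[of x] \<open>lam1 > 0\<close> that by (simp add: mult_le_0_iff)
    then show ?thesis using inner_gt_zero_iff[of x] by linarith
  qed
  then have Q_inv: "invertible Q"
    using invertible_left_inverse matrix_left_invertible_ker by blast
  have F_inv: "invertible F"
    unfolding assms(6) by (rule invertible_line_dynamics) fact

  define G where "G = (\<lambda>i. matrix_inv F ** Y i)"
  define D where "D = block_diag G"
  define P :: "ratfun^('n \<times> 2)^('n \<times> 2)" where "P = map_matrix rconst Q \<otimes>\<^sub>K mat 1"
  define L where "L = open_loop Q F Y"
  have PL: "P ** (mat 1 + L) = P - D" and P_inv: "invertible P"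
    using open_loop_eq[OF Q_inv F_inv] by (simp_all add: P_def L_def D_def G_def)

  \<comment> \<open>Including 0 in the maximum makes the intermediate \<open>c\<close> nonnegative,
    as \<open>norm_block_diag_le\<close> requires, while \<open>lam1 - c\<close> stays a positive
    margin.\<close>
  have "max (MAX i. hinf_norm (G i)) 0 < ereal lam1"
    using assms(7,10) by (simp add: G_def)
  then obtain c where c: "max (MAX i. hinf_norm (G i)) 0 < ereal c" "ereal c < ereal lam1"
    using ereal_dense2 by blast
  then have "0 \<le> c" "c < lam1" by auto
  have hinf: "hinf_norm (G i) < ereal c" for i
    using c(1) Max_ge[of "range (\<lambda>i. hinf_norm (G i))" "hinf_norm (G i)"] by simp
  have D_le: "norm (meval D z *v x) \<le> c * norm x" if "0 < Re z" for z x
  proof -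
    have eq: "meval D z = block_diag (\<lambda>i. meval (G i) z)"
      by (simp add: vec_eq_iff D_def block_diag_def meval_def reval_0)
    have le: "norm (meval (G i) z *v y) \<le> c * norm y" for i y
      by (intro stable_half_plane_bound hinf_norm_less_imp[OF hinf] that)
    show ?thesis unfolding eq by (rule norm_block_diag_le[OF \<open>0 \<le> c\<close> le])
  qed
  have D_poles: "z \<notin> mpoles D" if "0 < Re z" for z
    using proper_stable_mpoles[OF hinf_norm_less_imp(1)[OF hinf]] that
    by (auto simp: D_def mpoles_def block_diag_def reval_0 split: if_splits)
  have P_entry: "P $ r $ s = rconst ((Q \<otimes>\<^sub>K mat 1) $ r $ s)" for r s
    by (simp add: P_def kronecker_def mat_def)
  have P_poles: "z \<notin> mpoles P" for z
    by (simp add: mpoles_def P_entry reval_rconst)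
  have P_eval: "meval P z = map_matrix of_real Q \<otimes>\<^sub>K mat 1" for z
    by (simp add: vec_eq_iff meval_def P_entry reval_rconst) (simp add: kronecker_def mat_def)

  have ge: "(lam1 - c) * norm x \<le> norm (meval (P - D) z *v x)" if "0 < Re z" for z x
  proof -
    have "lam1 * norm x \<le> norm (meval P z *v x)"
      unfolding P_eval by (rule norm_kronecker_ge) (rule Q_ge)
    moreover have "norm (meval P z *v x) - norm (meval D z *v x) \<le> norm (meval P z *v x - meval D z *v x)"
      by (rule norm_triangle_ineq2)
    ultimately show ?thesis
      using D_le[OF that, of x] meval_diff(1)[OF P_poles D_poles[OF that]]
      by (simp add: matrix_vector_mult_diff_rdistrib left_diff_distrib)
  qed
  have "invertible (P - D)"
    by (rule invertible_if_coercive[of "lam1 - c"]) (use \<open>c < lam1\<close> ge in auto)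
  moreover have "mat 1 + L = matrix_inv P ** (P - D)"
    by (simp add: PL[symmetric] matrix_mul_assoc matrix_inv_mult[OF P_inv])
  moreover have "invertible (matrix_inv P)"
    using matrix_inv_mult[OF P_inv] by (auto simp: invertible_def)
  ultimately have L_inv: "invertible (mat 1 + L)" by (simp add: invertible_mult)

  define M where "M = matrix_inv (mat 1 + L)"
  have "P ** (mat 1 + L) ** M = P"
    unfolding M_def by (simp add: matrix_inv_mult[OF L_inv] flip: matrix_mul_assoc)
  \<comment> \<open>The closed-loop inverse \<open>M\<close> solves an equation with coercive
    coefficient \<open>P - D\<close> and constant right-hand side \<open>P\<close>, which bounds its
    entries.\<close>
  then have PDM: "(P - D) ** M = P" by (simp add: PL)
  have "proper_stable M"
  proof (rule meval_bound_imp_proper_stable[OF finite_mpoles])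
    fix z i j assume z: "0 < Re z" "z \<notin> mpoles M"
    let ?P = "map_matrix of_real Q \<otimes>\<^sub>K mat 1 :: complex^('n \<times> 2)^('n \<times> 2)"
    have "z \<notin> mpoles (P - D)" by (rule meval_diff(2)[OF P_poles D_poles[OF z(1)]])
    then have eval: "meval (P - D) z ** meval M z = ?P"
      using meval_mult[OF _ z(2)] PDM P_eval by metis
    have "norm (meval M z $ i $ j) \<le> norm (\<chi> r. (meval (P - D) z ** meval M z) $ r $ j) / (lam1 - c)"
      by (rule column_norm_bound) (use \<open>c < lam1\<close> ge z in auto)
    \<comment> \<open>Summing over all columns gives one constant for every entry, independent also
      of \<open>z\<close> because \<open>?P\<close> is constant.\<close>
    also have "\<dots> \<le> (\<Sum>j\<in>UNIV. norm (\<chi> r. ?P $ r $ j) / (lam1 - c))"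
      unfolding eval using \<open>c < lam1\<close> by (intro member_le_sum) auto
    finally show "norm (meval M z $ i $ j) \<le> (\<Sum>j\<in>UNIV. norm (\<chi> r. ?P $ r $ j) / (lam1 - c))" .
  qed
  then show ?thesis
    using L_inv by (simp add: closed_loop_stable_def L_def M_def)
qed

end
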